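(* Let $n$ be a positive integer. For any $w\in Q_n$, we have $1\le|\{i\in\{1,\ldots,2n\}: d(i)=0\}|\le n$, where $d(i)$ is the displacement of car $i$ in $w$.
   Context: A Stirling permutation of order $n$ is a permutation $w = w(1)w(2)\cdots w(2n)$ of the multiset $\{1,1,2,2,\ldots,n,n\}$ such that any value $j$ appearing between the two instances of $i$ satisfies $j>i$. $Q_n$ denotes the set of Stirling permutations of order $n$. Parking interpretation: there is a one-way street with spots $1,\ldots,2n$ (in this order), and cars $1,2,\ldots,2n$ arrive in order, car $i$ having preferred spot $w(i)$. Car $i$ parks in spot $w(i)$ if it is available; otherwise it continues down the street and parks in the first available spot after $w(i)$. For every $w\in Q_n$ all cars park. If car $i$ parks in spot $p(i)$, its displacement is $d(i)=p(i)-w(i)$. *)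

theory Defs
  imports Main "HOL-Library.Multiset"
begin

text \<open>
  A word \<open>w(1) \<dots> w(2n)\<close> is a list, so \<open>w(i)\<close> is \<open>w ! (i - 1)\<close>. Cars and spots are
  numbered from 1.
\<close>

definition stirling_permutations :: "nat \<Rightarrow> nat list set" where
  "stirling_permutations n =
     {w. mset w = mset_set {1..n} + mset_set {1..n} \<and>
         (\<forall>a b c. a < b \<and> b < c \<and> c < length w \<and> w ! a = w ! c \<longrightarrow> w ! b > w ! a)}"

text \<open>
  The spot taken by a car with preferred spot \<open>a\<close> on a street with spots \<open>1, \<dots>, m\<close>, of which
  those in \<open>occ\<close> are occupied; \<open>None\<close> if the car leaves the street without parking.
\<close>

definition choose_spot :: "nat \<Rightarrow> nat set \<Rightarrow> nat \<Rightarrow> nat option" where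
  "choose_spot m occ a =
     (if a \<in> {1..m} - occ then Some a
      else if {a<..m} - occ \<noteq> {} then Some (Min ({a<..m} - occ))
      else None)"

text \<open>Outcomes for cars arriving in list order, starting with the spots in \<open>occ\<close> occupied.\<close>

primrec park :: "nat \<Rightarrow> nat set \<Rightarrow> nat list \<Rightarrow> nat option list" where
  "park m occ [] = []"
| "park m occ (a # as) =
     (case choose_spot m occ a of
        None \<Rightarrow> None # park m occ as
      | Some s \<Rightarrow> Some s # park m (insert s occ) as)"

text \<open>There are as many spots as cars, namely \<open>length w\<close>, and the street is initially empty.\<close>

definition parking_spot :: "nat list \<Rightarrow> nat \<Rightarrow> nat option" where
  "parking_spot w i = park (length w) {} w ! (i - 1)"

text \<open>
  The displacement \<open>d(i) = p(i) - w(i)\<close>, taken in the integers to avoid truncated subtraction;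
  it is \<open>None\<close> for a car that does not park.
\<close>

definition displacement :: "nat list \<Rightarrow> nat \<Rightarrow> int option" where
  "displacement w i = map_option (\<lambda>p. int p - int (w ! (i - 1))) (parking_spot w i)"

end

theory Submission
  imports Defs
begin

text \<open>
  The first car always gets its preferred spot. A lucky car occupies its preferred spot, and parked
  cars occupy distinct spots, so lucky cars have distinct preferences, all of them in
  \<open>{1, \<dots>, n}\<close>.
\<close>

lemma choose_spot_notin: "choose_spot m occ a = Some s \<Longrightarrow> s \<notin> occ"
  using Min_in[of "{a<..m} - occ"] by (auto simp: choose_spot_def split: if_splits)

text \<open>The occupied set only grows as the recursion proceeds, so a spot that is free when car
  \<open>i\<close> arrives was already free at the start.\<close>

lemma park_notin: "i < length as \<Longrightarrow> park m occ as ! i = Some s \<Longrightarrow> s \<notin> occ"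
proof (induction as arbitrary: occ i)
  case (Cons a as)
  then show ?case
    by (cases i) (auto dest: choose_spot_notin split: option.splits)
qed simp

text \<open>The induction strips cars off the front until the earlier car is the head; its spot
  \<open>s\<close> then belongs to the occupied set passed to the remaining cars, and
  \<open>park_notin\<close> excludes it for each of them.\<close>

lemma park_nth_less:
  "i < j \<Longrightarrow> j < length as \<Longrightarrow> park m occ as ! i = Some s \<Longrightarrow> park m occ as ! j \<noteq> Some s"
proof (induction as arbitrary: occ i j)
  case (Cons a as)
  obtain j' where j: "j = Suc j'" "j' < length as"
    using Cons.prems by (cases j) auto
  show ?case
  proof (cases i)
    case 0
    then show ?thesis
      using Cons.prems j by (auto dest: park_notin split: option.splits)
  next
    case (Suc i')
    then show ?thesis
      using Cons.prems Cons.IH[of i' j'] j by (auto split: option.splits)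
  qed
qed simp

text \<open>Cars with outcome \<open>None\<close> are left out of the domain, since several of them
  would share that value.\<close>

lemma inj_on_park:
  "inj_on (\<lambda>i. park m occ as ! i) {i. i < length as \<and> park m occ as ! i \<noteq> None}"
proof (rule linorder_inj_onI', rule notI)
  fix i j
  assume "i \<in> {i. i < length as \<and> park m occ as ! i \<noteq> None}"
    and j: "j \<in> {i. i < length as \<and> park m occ as ! i \<noteq> None}"
    and "i < j" and eq: "park m occ as ! i = park m occ as ! j"
  then obtain s where "park m occ as ! i = Some s"
    by blast
  with park_nth_less[OF \<open>i < j\<close> _ this] j eq show False
    by simp
qed

lemma displacement_eq_0_iff:
  "displacement w i = Some 0 \<longleftrightarrow> parking_spot w i = Some (w ! (i - 1))"
  by (auto simp: displacement_def)

lemma stirling_permutations_length: "w \<in> stirling_permutations n \<Longrightarrow> length w = 2 * n"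
  unfolding stirling_permutations_def size_mset[symmetric] by simp

lemma stirling_permutations_set: "w \<in> stirling_permutations n \<Longrightarrow> set w = {1..n}"
  unfolding stirling_permutations_def set_mset_mset[symmetric] by simp

theorem corollary5p6:
  fixes n :: nat and w :: "nat list"
  assumes "n \<ge> 1"
    and "w \<in> stirling_permutations n"
  shows "1 \<le> card {i \<in> {1..2 * n}. displacement w i = Some 0} \<and>
    card {i \<in> {1..2 * n}. displacement w i = Some 0} \<le> n"
proof
  let ?L = "{i \<in> {1..2 * n}. displacement w i = Some 0}"
  have len: "length w = 2 * n" and set: "set w = {1..n}"
    using assms by (simp_all add: stirling_permutations_length stirling_permutations_set)
  obtain a v where w: "w = a # v"
    using len assms(1) by (cases w) auto
  have "a \<in> {1..n}"
    unfolding set[symmetric] w by simp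
  \<comment> \<open>On the empty street, a preferred spot is available as soon as it exists.\<close>
  then have "a \<in> {1..length w}"
    using len by simp
  then have "displacement w 1 = Some 0"
    by (simp add: displacement_eq_0_iff parking_spot_def w choose_spot_def)
  then have "1 \<in> ?L"
    using assms(1) by simp
  moreover have "finite ?L" by simp
  ultimately show "1 \<le> card ?L"
    by (metis One_nat_def Suc_leI card_gt_0_iff empty_iff)
  have "inj_on (\<lambda>i. w ! (i - 1)) ?L"
  proof (rule inj_onI)
    fix i j
    assume ij: "i \<in> ?L" "j \<in> ?L" "w ! (i - 1) = w ! (j - 1)"
    \<comment> \<open>Both cars are lucky, so their common preference is the spot in which each of
      them parks.\<close>
    then have "park (length w) {} w ! (i - 1) = park (length w) {} w ! (j - 1)"
      by (simp add: displacement_eq_0_iff parking_spot_def)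
    then have "i - 1 = j - 1"
      by (rule inj_onD[OF inj_on_park])
        (use ij len in \<open>auto simp: displacement_eq_0_iff parking_spot_def\<close>)
    \<comment> \<open>Cars are numbered from 1, so the truncated subtraction loses nothing.\<close>
    then show "i = j"
      using ij by auto
  qed
  \<comment> \<open>The upper bound is the number of distinct values in \<open>w\<close>, half its
    length.\<close>
  moreover have "(\<lambda>i. w ! (i - 1)) ` ?L \<subseteq> {1..n}"
    unfolding set[symmetric] using len by auto
  ultimately show "card ?L \<le> n"
    using card_inj_on_le[of _ ?L "{1..n}"] by simp
qed

end
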